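(* Let $\alpha_1,\alpha_2,\dots,\alpha_M$ be complex numbers, let $F_M(z)=\prod_{m=1}^M(z-\alpha_m)$, and assume that $|\alpha_m|\le1$ for each $m=1,2,\dots,M$. Then for each nonnegative integer $N$ we have $$\sup_{|z|\le1}\log|F_M(z)|\le M(N+1)^{-1}\log2+\sum_{n=1}^Nn^{-1}\left|\sum_{m=1}^M(\alpha_m)^n\right|.$$
   Context: $M$ is a positive integer, and $\log 0=-\infty$. *)

theory Defs
  imports "HOL-Analysis.Analysis"
begin

text \<open>
  Natural logarithm of a nonnegative real, with \<open>log 0 = -\<infinity>\<close>; the library's \<^const>\<open>ln\<close> is \<open>0\<close> at \<open>0\<close>.
  The values at negative arguments are junk.
\<close>
definition elog :: "real \<Rightarrow> ereal" where
  "elog x = (if x = 0 then -\<infinity> else ereal (ln x))"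

definition F_poly :: "nat \<Rightarrow> (nat \<Rightarrow> complex) \<Rightarrow> complex \<Rightarrow> complex" where
  "F_poly M \<alpha> z = (\<Prod>m=1..M. z - \<alpha> m)"

end

theory Submission
  imports Defs "HOL-Complex_Analysis.Conformal_Mappings"
begin

text \<open>
  Write \<open>L = N + 1\<close>. On the unit circle \<open>-ln |1 - w|\<close> is the integral over \<open>r\<close> in \<open>[0,1]\<close> of
  \<open>Re (w / (1 - r w)) = (P\<^sub>r(w) - 1) / (2 r)\<close>, where \<open>P\<^sub>r(w) = (1 - r\<^sup>2) / |1 - r w|\<^sup>2\<close> is the Poisson kernel.
  Subtracting from \<open>P\<^sub>r\<close> the nonnegative function \<open>2 r^L (1 + r^L)^(-2) (1 + Re (w^L)) P\<^sub>r(w)\<close>, whose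
  constant is chosen so that the numerator cancels the zeros \<open>w = r\<close> and \<open>w = 1 / r\<close> of the denominator,
  leaves a trigonometric polynomial of degree \<open>N\<close>. Integrating its coefficients over \<open>r\<close> yields
  \<open>ln |1 - w| \<le> ln 2 / L - (\<Sum>n=1..N. c\<^sub>n Re (w^n))\<close> with \<open>0 \<le> c\<^sub>n \<le> 1/n\<close>, and the maximum modulus principle
  extends this to the closed disc. Since \<open>|z - \<alpha>| \<le> |1 - \<alpha> cnj z|\<close> there, one takes \<open>w = \<alpha>\<^sub>m cnj z\<close> and sums over \<open>m\<close>.
\<close>

text \<open>Coefficient of \<open>Re (w ^ n)\<close> in the trigonometric polynomial described
  above, after division by \<open>2 r\<close>. At \<open>n = N + 1\<close> the two powers of
  \<open>r\<close> agree, which is where the degree breaks off.\<close>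

definition kernel_coeff :: "nat \<Rightarrow> nat \<Rightarrow> real \<Rightarrow> real" where
  "kernel_coeff N n r = (r ^ (n - 1) - r ^ (2 * N + 1 - n)) / (1 + r ^ Suc N)\<^sup>2"

definition majorant_coeff :: "nat \<Rightarrow> nat \<Rightarrow> real" where
  "majorant_coeff N n = integral {0..1} (kernel_coeff N n)"

text \<open>Geometric sums for the two powers of \<open>r\<close> in \<open>kernel_coeff\<close>,
  kept free of division so that they hold for every \<open>r\<close> and \<open>w\<close>.\<close>

lemma sum_kernel_powers:
  fixes r :: real and w :: complex
  shows "(1 - of_real r * w) * (\<Sum>n=1..N. of_real (r ^ (n - 1)) * w ^ n) = w * (1 - of_real (r ^ N) * w ^ N)"
    and "(w - of_real r) * (\<Sum>n=1..N. of_real (r ^ (2 * N + 1 - n)) * w ^ n)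
      = of_real (r ^ Suc N) * w * (w ^ N - of_real (r ^ N))"
proof -
  have "(\<Sum>n=1..N. of_real (r ^ (n - 1)) * w ^ n) = w * (\<Sum>k<N. (of_real r * w) ^ k)"
    unfolding sum_distrib_left
  proof (rule sum.reindex_bij_witness[of _ Suc "\<lambda>n. n - 1"])
    fix n assume "n \<in> {1..N}"
    then have "w ^ n = w * w ^ (n - 1)" by (simp flip: power_Suc)
    then show "w * (of_real r * w) ^ (n - 1) = of_real (r ^ (n - 1)) * w ^ n"
      by (simp only: of_real_power power_mult_distrib mult_ac)
  qed auto
  moreover have "(1 - of_real r * w) * (\<Sum>k<N. (of_real r * w) ^ k) = 1 - (of_real r * w) ^ N"
    by (rule one_diff_power_eq[symmetric])
  ultimately show "(1 - of_real r * w) * (\<Sum>n=1..N. of_real (r ^ (n - 1)) * w ^ n)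
      = w * (1 - of_real (r ^ N) * w ^ N)"
    by (simp add: power_mult_distrib mult.left_commute)
next
  have "(\<Sum>n=1..N. of_real (r ^ (2 * N + 1 - n)) * w ^ n)
      = of_real (r ^ Suc N) * w * (\<Sum>k<N. of_real r ^ (N - Suc k) * w ^ k)"
    unfolding sum_distrib_left
  proof (rule sum.reindex_bij_witness[of _ Suc "\<lambda>n. n - 1"])
    fix n assume n: "n \<in> {1..N}"
    then have "2 * N + 1 - n = Suc N + (N - Suc (n - 1))" and "n = Suc (n - 1)" by auto
    then have "r ^ (2 * N + 1 - n) = r ^ Suc N * r ^ (N - Suc (n - 1))" "w ^ n = w * w ^ (n - 1)"
      by (metis power_add, metis power_Suc)
    then show "of_real (r ^ Suc N) * w * (of_real r ^ (N - Suc (n - 1)) * w ^ (n - 1))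
        = of_real (r ^ (2 * N + 1 - n)) * w ^ n"
      by (simp only: of_real_mult of_real_power mult_ac)
  qed auto
  moreover have "(w - of_real r) * (\<Sum>k<N. of_real r ^ (N - Suc k) * w ^ k) = w ^ N - of_real r ^ N"
    by (rule power_diff_sumr2[symmetric])
  ultimately show "(w - of_real r) * (\<Sum>n=1..N. of_real (r ^ (2 * N + 1 - n)) * w ^ n)
      = of_real (r ^ Suc N) * w * (w ^ N - of_real (r ^ N))"
    by (simp add: mult.left_commute)
qed

text \<open>With \<open>D\<close> the denominator on the right, the gap between the two sides is
  \<open>r ^ N * (1 + Re (w ^ Suc N)) * (1 - r\<^sup>2) / ((1 + r ^ Suc N)\<^sup>2 * D)\<close>.
  This is the nonnegative function of the overview divided by \<open>2 r\<close>, in a form that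
  includes \<open>r = 0\<close>. Positivity of \<open>D\<close> excludes only \<open>r = 1\<close>,
  \<open>w = 1\<close>.\<close>

lemma kernel_minorant:
  fixes r :: real and w :: complex
  assumes w: "norm w = 1" and r: "0 \<le> r" "r \<le> 1" and D: "1 - 2 * r * Re w + r\<^sup>2 > 0"
  shows "(\<Sum>n=1..N. kernel_coeff N n r * Re (w ^ n)) - r ^ N / (1 + r ^ Suc N)
    \<le> (Re w - r) / (1 - 2 * r * Re w + r\<^sup>2)"
proof -
  define a b where "a = Re w" and "b = Im w"
  define c d where "c = Re (w ^ N)" and "d = Im (w ^ N)"
  define R D where "R = r ^ N" and "D = 1 - 2 * r * a + r\<^sup>2"
  define S1 where "S1 = (\<Sum>n=1..N. of_real (r ^ (n - 1)) * w ^ n)"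
  define S2 where "S2 = (\<Sum>n=1..N. of_real (r ^ (2 * N + 1 - n)) * w ^ n)"
  have R: "R \<ge> 0" using r by (simp add: R_def)
  have E: "1 + r * R > 0" using r R by (simp add: add_pos_nonneg)
  have ab: "a\<^sup>2 + b\<^sup>2 = 1" using w cmod_power2[of w] by (simp add: a_def b_def)
  have sq: "w * cnj w = 1" using w by (simp add: complex_norm_square[symmetric])
  \<comment> \<open>\<open>D\<close> is \<open>|1 - r w|^2\<close>. On the circle its second factor
    equals \<open>cnj w * (w - r)\<close>, so \<open>D\<close> clears the denominators of both
    geometric sums.\<close>
  have D': "complex_of_real D = (1 - of_real r * w) * (1 - of_real r * cnj w)"
    using ab by (auto simp: complex_eq_iff D_def a_def b_def power2_eq_square algebra_simps)
      (metis (no_types) distrib_left mult.right_neutral)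
  have "of_real D * S1 = (1 - of_real r * cnj w) * (w * (1 - of_real R * w ^ N))"
    unfolding D' S1_def R_def sum_kernel_powers(1)[symmetric] by (simp only: mult_ac)
  also have "\<dots> = (w - of_real r * (w * cnj w)) * (1 - of_real R * w ^ N)"
    by (simp add: algebra_simps)
  also have "\<dots> = (w - of_real r) * (1 - of_real R * w ^ N)"
    by (simp add: sq)
  finally have S1: "D * Re S1 = (a - r) * (1 - R * c) + b * (R * d)"
    by (auto dest!: arg_cong[of _ _ Re] simp: a_def b_def c_def d_def)
  have "of_real D * S2 = (1 - of_real r * w) * ((w * cnj w - of_real r * cnj w) * S2)"
    unfolding D' sq by (simp only: mult.assoc)
  also have "(w * cnj w - of_real r * cnj w) * S2 = cnj w * ((w - of_real r) * S2)"
    by (simp add: algebra_simps)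
  also have "(w - of_real r) * S2 = of_real (r ^ Suc N) * w * (w ^ N - of_real (r ^ N))"
    unfolding S2_def by (rule sum_kernel_powers)
  also have "cnj w * \<dots> = (w * cnj w) * (of_real (r * R) * (w ^ N - of_real R))"
    by (simp add: R_def)
  finally have "of_real D * S2 = (1 - of_real r * w) * (of_real (r * R) * (w ^ N - of_real R))"
    using sq by simp
  then have S2: "D * Re S2 = r * R * ((1 - r * a) * (c - R) + r * b * d)"
    by (auto dest!: arg_cong[of _ _ Re] simp: a_def b_def c_def d_def algebra_simps)
  have sum: "(\<Sum>n=1..N. kernel_coeff N n r * Re (w ^ n)) = (Re S1 - Re S2) / (1 + r * R)\<^sup>2"
    by (simp add: S1_def S2_def kernel_coeff_def R_def sum_subtractf sum_divide_distrib
        diff_divide_distrib left_diff_distrib)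
  have "\<bar>c\<bar> \<le> 1" using abs_Re_le_cmod[of "w ^ N"] w by (simp add: c_def norm_power)
  have "norm (w ^ Suc N) = 1" using w by (simp add: norm_mult norm_power)
  then have "- (a * c - b * d) \<le> 1"
    using abs_Re_le_cmod[of "w ^ Suc N"] by (simp add: a_def b_def c_def d_def)
  \<comment> \<open>Here \<open>a * c - b * d\<close> is \<open>Re (w ^ Suc N)\<close>, and the
    product is the gap multiplied by \<open>(1 + r * R)\<^sup>2 * D\<close>.\<close>
  then have "0 \<le> (1 - r\<^sup>2) * (R * (1 + (a * c - b * d)))"
    using r R by (intro mult_nonneg_nonneg) (auto simp: power_le_one)
  also have "\<dots> = (1 + r * R)\<^sup>2 * (a - r) + R * (1 + r * R) * D - D * Re S1 + D * Re S2"
    unfolding S1 S2 unfolding D_def by (simp add: power2_eq_square algebra_simps)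
  finally have "0 \<le> (\<dots>) / ((1 + r * R)\<^sup>2 * D)"
    using E D by (intro divide_nonneg_pos) (auto simp: D_def a_def)
  also have "\<dots> = (a - r) / D + R / (1 + r * R) - (Re S1 - Re S2) / (1 + r * R)\<^sup>2"
  proof -
    have "(e\<^sup>2 * (a - r) + R * e * D - D * Re S1 + D * Re S2) / (e\<^sup>2 * D)
        = (a - r) / D + R / e - (Re S1 - Re S2) / e\<^sup>2" if "e > 0" for e
      using that D[folded a_def, folded D_def] by (simp add: field_simps power2_eq_square)
    then show ?thesis using E .
  qed
  finally show ?thesis
    unfolding sum by (simp add: R_def D_def a_def)
qed

lemma continuous_on_kernel_coeff: "continuous_on {0..1} (kernel_coeff N n)"
proof -
  have "1 + r ^ Suc N > 0" if "r \<in> {0..1}" for r :: real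
    using that by (intro add_pos_nonneg zero_le_power) auto
  then have "\<forall>r\<in>{0..1::real}. (1 + r ^ Suc N)\<^sup>2 \<noteq> 0"
    by (metis less_irrefl power_eq_0_iff)
  then show ?thesis
    unfolding kernel_coeff_def by (intro continuous_intros)
qed

lemma has_integral_kernel_coeff: "(kernel_coeff N n has_integral majorant_coeff N n) {0..1}"
  unfolding majorant_coeff_def
  by (intro integrable_integral integrable_continuous_real continuous_on_kernel_coeff)

text \<open>Since \<open>n - 1 \<le> 2 * N + 1 - n\<close> and the denominator is at least 1, the
  integrand lies between 0 and \<open>r ^ (n - 1)\<close> on the unit interval, and the latter
  integrates to \<open>1 / n\<close>.\<close>

lemma majorant_coeff_bounds:
  assumes "n \<in> {1..N}"
  shows "0 \<le> majorant_coeff N n" "majorant_coeff N n \<le> 1 / real n"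
proof -
  have bounds: "0 \<le> kernel_coeff N n r" "kernel_coeff N n r \<le> r ^ (n - 1)" if "r \<in> {0..1}" for r
  proof -
    have nn: "0 \<le> r ^ (2 * N + 1 - n)" "0 \<le> r ^ Suc N" "0 \<le> r ^ (n - 1)"
      using that by (auto intro!: zero_le_power mult_nonneg_nonneg)
    have "r ^ (2 * N + 1 - n) \<le> r ^ (n - 1)"
      using that assms by (intro power_decreasing) auto
    then show "0 \<le> kernel_coeff N n r" by (simp add: kernel_coeff_def)
    have "1 \<le> (1 + r ^ Suc N)\<^sup>2" using nn(2) by (simp add: one_le_power)
    then have "kernel_coeff N n r \<le> (r ^ (n - 1) - r ^ (2 * N + 1 - n)) / 1"
      unfolding kernel_coeff_def
      using \<open>r ^ (2 * N + 1 - n) \<le> r ^ (n - 1)\<close> by (intro divide_left_mono) auto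
    then show "kernel_coeff N n r \<le> r ^ (n - 1)" using nn by simp
  qed
  show "0 \<le> majorant_coeff N n"
    using has_integral_nonneg[OF has_integral_kernel_coeff bounds(1)] .
  have "((\<lambda>r. r ^ (n - 1)) has_integral 1 ^ n / real n - 0 ^ n / real n) {0..1}"
    using assms
    by (intro fundamental_theorem_of_calculus)
       (auto intro!: derivative_eq_intros simp flip: has_real_derivative_iff_has_vector_derivative)
  then have "((\<lambda>r. r ^ (n - 1)) has_integral 1 / real n) {0..1}"
    using assms by (simp add: power_0_left)
  from has_integral_le[OF has_integral_kernel_coeff this bounds(2)]
  show "majorant_coeff N n \<le> 1 / real n" .
qed

text \<open>Integrate \<open>kernel_minorant\<close> over \<open>r\<close> from 0 to 1. Excluding
  \<open>w = 1\<close> keeps \<open>D r = |1 - r w|^2\<close> positive up to the endpoint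
  \<open>r = 1\<close>, so \<open>- ln (D r) / 2\<close> is an antiderivative of the right-hand side
  on the whole interval.\<close>

lemma ln_norm_one_minus_le_circle:
  assumes w: "norm w = 1" "w \<noteq> 1"
  shows "ln (norm (1 - w)) \<le> ln 2 / real (Suc N) - (\<Sum>n=1..N. majorant_coeff N n * Re (w ^ n))"
proof -
  define D where "D = (\<lambda>r. 1 - 2 * r * Re w + r\<^sup>2)"
  have ab: "(Re w)\<^sup>2 + (Im w)\<^sup>2 = 1" using w cmod_power2[of w] by simp
  have "Re w < 1"
    using w ab complex_Re_le_cmod[of w] by (cases "Re w = 1") (auto simp: complex_eq_iff)
  have D: "D r > 0" if "r \<in> {0..1}" for r
  proof -
    \<comment> \<open>The square is positive at \<open>r = 0\<close>, the other term for
      \<open>r > 0\<close>.\<close>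
    have "D r = (1 - r)\<^sup>2 + 2 * r * (1 - Re w)" by (simp add: D_def power2_eq_square algebra_simps)
    moreover have "\<dots> > 0" using that \<open>Re w < 1\<close>
      by (cases "r = 0") (auto intro!: add_nonneg_pos)
    ultimately show ?thesis by simp
  qed
  have "((\<lambda>r. (Re w - r) / D r) has_integral (- ln (D 1) / 2 - (- ln (D 0) / 2))) {0..1}"
  proof (rule fundamental_theorem_of_calculus)
    fix r :: real assume r: "r \<in> {0..1}"
    have "(D has_real_derivative (2 * (r - Re w))) (at r within {0..1})"
      unfolding D_def by (auto intro!: derivative_eq_intros)
    from DERIV_cdivide[OF DERIV_minus[OF DERIV_ln_divide[THEN DERIV_chain2, OF D[OF r] this]], of 2]
    have "((\<lambda>r. - ln (D r) / 2) has_real_derivative (Re w - r) / D r) (at r within {0..1})"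
      by (rule back_subst) (use D[OF r] in \<open>simp add: field_simps\<close>)
    then show "((\<lambda>r. - ln (D r) / 2) has_vector_derivative (Re w - r) / D r) (at r within {0..1})"
      by (simp add: has_real_derivative_iff_has_vector_derivative)
  qed simp
  moreover have "D 1 = (norm (1 - w))\<^sup>2"
    unfolding cmod_power2 using ab by (simp add: D_def power2_eq_square algebra_simps)
  then have "ln (D 1) = 2 * ln (norm (1 - w))"
    using w by (simp add: ln_realpow)
  ultimately have log_int: "((\<lambda>r. (Re w - r) / D r) has_integral - ln (norm (1 - w))) {0..1}"
    by (simp add: D_def)
  \<comment> \<open>The constant term of the minorant is the source of
    \<open>ln 2 / (N + 1)\<close>.\<close>
  have "((\<lambda>r. r ^ N / (1 + r ^ Suc N)) has_integral
      (ln (1 + 1 ^ Suc N) / real (Suc N) - ln (1 + 0 ^ Suc N) / real (Suc N))) {0..1::real}"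
  proof (rule fundamental_theorem_of_calculus)
    fix r :: real assume "r \<in> {0..1}"
    then have "1 + r ^ Suc N > 0" by (intro add_pos_nonneg zero_le_power) auto
    then show "((\<lambda>r. ln (1 + r ^ Suc N) / real (Suc N)) has_vector_derivative r ^ N / (1 + r ^ Suc N))
        (at r within {0..1})"
      unfolding has_real_derivative_iff_has_vector_derivative[symmetric]
      by (auto intro!: derivative_eq_intros simp del: power_Suc of_nat_Suc)
  qed simp
  then have "((\<lambda>r. r ^ N / (1 + r ^ Suc N)) has_integral ln 2 / real (Suc N)) {0..1::real}"
    by simp
  then have "((\<lambda>r. (\<Sum>n=1..N. kernel_coeff N n r * Re (w ^ n)) - r ^ N / (1 + r ^ Suc N)) has_integral
      (\<Sum>n=1..N. majorant_coeff N n * Re (w ^ n)) - ln 2 / real (Suc N)) {0..1}"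
    by (intro has_integral_diff has_integral_sum has_integral_mult_left has_integral_kernel_coeff) auto
  from has_integral_le[OF this log_int] kernel_minorant[OF w(1)] D
  show ?thesis by (simp add: D_def)
qed

text \<open>Exponentiated, the circle bound says that the entire function
  \<open>(1 - z) * exp (Q z)\<close> has modulus at most 1 on the unit circle, including the point
  \<open>z = 1\<close>, where it vanishes. The maximum modulus principle carries this to the closed
  disc.\<close>

lemma norm_one_minus_le:
  assumes "norm w \<le> 1"
  shows "norm (1 - w) \<le> exp (ln 2 / real (Suc N) - (\<Sum>n=1..N. majorant_coeff N n * Re (w ^ n)))"
proof -
  define Q :: "complex \<Rightarrow> complex" where "Q = (\<lambda>w. (\<Sum>n=1..N. of_real (majorant_coeff N n) * w ^ n) - of_real (ln 2 / real (Suc N)))"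
  have Re_Q: "Re (Q z) = (\<Sum>n=1..N. majorant_coeff N n * Re (z ^ n)) - ln 2 / real (Suc N)" for z
    by (simp add: Q_def del: of_nat_Suc)
  have hol: "(\<lambda>z. (1 - z) * exp (Q z)) holomorphic_on UNIV"
    unfolding Q_def by (intro holomorphic_intros)
  have "norm ((1 - w) * exp (Q w)) \<le> 1"
  proof (rule maximum_modulus_frontier[where S = "cball 0 1" and f = "\<lambda>z. (1 - z) * exp (Q z)"])
    fix z :: complex assume "z \<in> frontier (cball 0 1)"
    then have z: "norm z = 1" by simp
    show "norm ((1 - z) * exp (Q z)) \<le> 1"
    proof (cases "z = 1")
      case False
      then have "norm (1 - z) = exp (ln (norm (1 - z)))" by simp
      also have "\<dots> \<le> exp (- Re (Q z))"
        using ln_norm_one_minus_le_circle[OF z False, of N] by (simp only: exp_le_cancel_iff Re_Q)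
      finally show ?thesis unfolding norm_mult by (simp add: exp_minus field_simps)
    qed simp
  qed (use assms hol in \<open>auto intro: holomorphic_on_subset holomorphic_on_imp_continuous_on\<close>)
  then have "norm (1 - w) \<le> exp (- Re (Q w))"
    unfolding norm_mult by (simp add: exp_minus field_simps)
  then show ?thesis by (simp add: Re_Q)
qed

text \<open>The squares of the two norms differ by \<open>(1 - |z|^2) (1 - |\<alpha>|^2)\<close>, as
  for a Blaschke factor.\<close>

lemma norm_diff_le_norm_one_minus_mult_cnj:
  fixes z \<alpha> :: complex
  assumes "norm z \<le> 1" "norm \<alpha> \<le> 1"
  shows "norm (z - \<alpha>) \<le> norm (1 - \<alpha> * cnj z)"
proof (rule power2_le_imp_le)
  have "(norm (1 - \<alpha> * cnj z))\<^sup>2 - (norm (z - \<alpha>))\<^sup>2 = (1 - (norm z)\<^sup>2) * (1 - (norm \<alpha>)\<^sup>2)"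
    unfolding cmod_power2 by (simp add: power2_eq_square algebra_simps)
  moreover have "\<dots> \<ge> 0"
    using assms by (intro mult_nonneg_nonneg) (auto simp: power_le_one)
  ultimately show "(norm (z - \<alpha>))\<^sup>2 \<le> (norm (1 - \<alpha> * cnj z))\<^sup>2" by linarith
qed simp

text \<open>The exponential form also covers the zeros of \<open>F_poly\<close>. Multiplying the
  factor bounds and exchanging the sums over \<open>m\<close> and \<open>n\<close> makes the power
  sums of the \<open>\<alpha> m\<close> appear.\<close>

lemma norm_F_poly_le:
  assumes \<alpha>: "\<And>m. m \<in> {1..M} \<Longrightarrow> norm (\<alpha> m) \<le> 1" and z: "norm z \<le> 1"
  shows "norm (F_poly M \<alpha> z) \<le> exp (real M * inverse (real (N + 1)) * ln 2
        + (\<Sum>n=1..N. inverse (real n) * norm (\<Sum>m=1..M. \<alpha> m ^ n)))"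
proof -
  let ?c = "majorant_coeff N"
  have "norm (F_poly M \<alpha> z) \<le> (\<Prod>m=1..M. exp (ln 2 / real (Suc N)
      - (\<Sum>n=1..N. ?c n * Re ((\<alpha> m * cnj z) ^ n))))"
    unfolding F_poly_def prod_norm[symmetric]
  proof (rule prod_mono)
    fix m assume m: "m \<in> {1..M}"
    have "norm (\<alpha> m * cnj z) \<le> 1" using \<alpha>[OF m] z by (simp add: norm_mult mult_le_one)
    from order_trans[OF norm_diff_le_norm_one_minus_mult_cnj[OF z \<alpha>[OF m]] norm_one_minus_le[OF this]]
    show "0 \<le> norm (z - \<alpha> m) \<and> norm (z - \<alpha> m) \<le> exp (ln 2 / real (Suc N)
      - (\<Sum>n=1..N. ?c n * Re ((\<alpha> m * cnj z) ^ n)))" by simp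
  qed
  also have "\<dots> = exp (\<Sum>m=1..M. ln 2 / real (Suc N) - (\<Sum>n=1..N. ?c n * Re ((\<alpha> m * cnj z) ^ n)))"
    by (simp add: exp_sum)
  also have "(\<Sum>m=1..M. ln 2 / real (Suc N) - (\<Sum>n=1..N. ?c n * Re ((\<alpha> m * cnj z) ^ n)))
      = real M * inverse (real (N + 1)) * ln 2 + (\<Sum>n=1..N. \<Sum>m=1..M. - (?c n * Re ((\<alpha> m * cnj z) ^ n)))"
    by (subst sum.swap[of _ "{1..M}"]) (simp add: sum_subtractf sum_negf divide_inverse mult_ac)
  also have "\<dots> \<le> real M * inverse (real (N + 1)) * ln 2
      + (\<Sum>n=1..N. inverse (real n) * norm (\<Sum>m=1..M. \<alpha> m ^ n))"
  proof (intro add_left_mono sum_mono)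
    fix n assume n: "n \<in> {1..N}"
    let ?s = "\<Sum>m=1..M. \<alpha> m ^ n"
    have "(\<Sum>m=1..M. - (?c n * Re ((\<alpha> m * cnj z) ^ n))) = ?c n * - Re (?s * cnj z ^ n)"
      by (simp add: power_mult_distrib sum_distrib_left sum_distrib_right sum_negf)
    \<comment> \<open>Nonnegativity of the coefficient is what allows \<open>- Re\<close> to be
      replaced by the norm.\<close>
    also have "\<dots> \<le> ?c n * norm (?s * cnj z ^ n)"
      using abs_Re_le_cmod[of "?s * cnj z ^ n"] majorant_coeff_bounds[OF n]
      by (intro mult_left_mono) linarith+
    \<comment> \<open>As \<open>|cnj z ^ n| \<le> 1\<close>, the dependence on \<open>z\<close>
      disappears, which makes the bound uniform on the disc.\<close>
    also have "\<dots> \<le> inverse (real n) * norm ?s"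
      using majorant_coeff_bounds[OF n] z
      by (intro mult_mono) (auto simp: norm_mult norm_power divide_inverse power_le_one mult_left_le)
    finally show "(\<Sum>m=1..M. - (?c n * Re ((\<alpha> m * cnj z) ^ n))) \<le> inverse (real n) * norm ?s" .
  qed
  finally show ?thesis by simp
qed

theorem theorem8p1:
  fixes M N :: nat and \<alpha> :: "nat \<Rightarrow> complex"
  assumes "M \<ge> 1"
    and "\<And>m. m \<in> {1..M} \<Longrightarrow> norm (\<alpha> m) \<le> 1"
  shows "(SUP z\<in>{z. norm z \<le> 1}. elog (norm (F_poly M \<alpha> z)))
    \<le> ereal (real M * inverse (real (N + 1)) * ln 2
        + (\<Sum>n=1..N. inverse (real n) * norm (\<Sum>m=1..M. \<alpha> m ^ n)))"
    (is "_ \<le> ereal ?B")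
proof (rule SUP_least)
  fix z :: complex assume "z \<in> {z. norm z \<le> 1}"
  with assms(2) have le: "norm (F_poly M \<alpha> z) \<le> exp ?B" by (intro norm_F_poly_le) auto
  show "elog (norm (F_poly M \<alpha> z)) \<le> ereal ?B"
  \<comment> \<open>At a zero \<open>elog\<close> takes the value \<open>-\<infinity>\<close> and
    the bound is trivial; elsewhere \<open>ln\<close> is monotone on the positive norms.\<close>
  proof (cases "F_poly M \<alpha> z = 0")
    case False
    then have "ln (norm (F_poly M \<alpha> z)) \<le> ln (exp ?B)"
      by (subst ln_le_cancel_iff) (use le in auto)
    with False show ?thesis by (simp add: elog_def)
  qed (simp add: elog_def)
qed

end
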